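(* Let $k$ be a field of characteristic different from $2$. Let $p$ be an odd prime, $r\ge1$ and $m\ge 2$ integers with $q:=p^r$ satisfying $q+1=2^m$. Let $e_1,\dots,e_q$ be an enumeration of the finite field $\mathbb{F}_q$ and let $Q$ be the $q\times q$ matrix $Q_{ij}=\chi(e_i-e_j)$. Let $G=(\mathbb{Z}_2)^m$ with an enumeration $g_0,g_1,\dots,g_q$ of its elements with $g_0=e$ the identity, and let $F:G\times G\to k^*$ be the 2-cochain whose matrix $(F(g_i,g_j))_{0\le i,j\le q}$ is $$H=\begin{pmatrix}1&1&\cdots&1\\ 1&&&\\ \vdots&&-Q-I&\\ 1&&&\end{pmatrix},$$ i.e. $F(e,x)=F(x,e)=1$ for all $x\in G$, $F(x,x)=-1$ for $x\ne e$, and $F(g_i,g_j)=-\chi(e_i-e_j)$ for $i,j>0$, $i\ne j$. Then the algebra $k_FG$ is simple and noncommutative.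
   Context: $\chi:\mathbb{F}_q\to\{0,1,-1\}$ is the quadratic character: $\chi(0)=0$, $\chi(x)=1$ if $x$ is a nonzero square and $\chi(x)=-1$ if $x$ is not a square. $I$ is the identity matrix. $k_FG$ is the $k$-vector space with basis $G$ and bilinear product $x\cdot y=F(x,y)\,xy$ for $x,y\in G$, where $xy$ is the product in the group $G$. An algebra is simple if its product is nonzero and it has no two-sided ideals other than $0$ and itself. *)

theory Defs
  imports
    "HOL-Analysis.Cartesian_Space"
    "HOL-Library.Z2"
    "HOL-Computational_Algebra.Primes"
    "Jordan_Normal_Form.Matrix"
begin

no_notation vec_index (infixl "$" 100)
hide_const (open) Matrix.vec Finite_Cartesian_Product.mat

(* The group (Z_2)^m is the additive group of bit ^ 'n with CARD('n) = m; this instance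
   makes bit ^ 'n a finite type. *)
instance bit :: finite
proof
  have "(UNIV :: bit set) \<subseteq> {0, 1}"
  proof
    fix b :: bit
    show "b \<in> {0, 1}"
      by (cases b) simp_all
  qed
  then show "finite (UNIV :: bit set)"
    by (rule finite_subset) simp
qed

definition quadratic_character :: "'f::field \<Rightarrow> int" where
  "quadratic_character x =
     (if x = 0 then 0 else if \<exists>y. x = y ^ 2 then 1 else - 1)"

(* Matrix indices start at 0, so position (i, j) holds chi(e_(i+1) - e_(j+1)). *)
definition paley_Q :: "nat \<Rightarrow> (nat \<Rightarrow> 'f::field) \<Rightarrow> 'k::field mat" where
  "paley_Q q e =
     mat q q (\<lambda>(i, j). of_int (quadratic_character (e (i + 1) - e (j + 1))))"

definition paley_H :: "nat \<Rightarrow> (nat \<Rightarrow> 'f::field) \<Rightarrow> 'k::field mat" where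
  "paley_H q e =
     four_block_mat (mat 1 1 (\<lambda>_. 1)) (mat 1 q (\<lambda>_. 1))
                    (mat q 1 (\<lambda>_. 1)) (- paley_Q q e - 1\<^sub>m q)"

definition cochain_matrix :: "nat \<Rightarrow> (nat \<Rightarrow> 'g) \<Rightarrow> ('g \<Rightarrow> 'g \<Rightarrow> 'k) \<Rightarrow> 'k mat" where
  "cochain_matrix n g F = mat n n (\<lambda>(i, j). F (g i) (g j))"

(* k_F G has underlying vector space 'k ^ 'g with basis axis x 1, x in G; G is written additively. *)
definition twisted_mult ::
  "('g::{finite,group_add} \<Rightarrow> 'g \<Rightarrow> 'k::field) \<Rightarrow>
     'k ^ 'g::{finite,group_add} \<Rightarrow> 'k ^ 'g::{finite,group_add} \<Rightarrow> 'k ^ 'g::{finite,group_add}" where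
  "twisted_mult F a b =
     (\<Sum>x\<in>UNIV. \<Sum>y\<in>UNIV. (a $ x * b $ y * F x y) *s axis (x + y) 1)"

lemma twisted_mult_axis:
  fixes F :: "'g::{finite,group_add} \<Rightarrow> 'g \<Rightarrow> 'k::field"
  shows "twisted_mult F (axis x 1) (axis y 1) = F x y *s axis (x + y) 1"
proof -
  have ax: "(axis z 1 :: 'k ^ 'g::{finite,group_add}) $ u = (if u = z then 1 else 0)" for z u
    by (simp add: axis_def)
  have "twisted_mult F (axis x 1) (axis y 1) =
      (\<Sum>u\<in>UNIV. \<Sum>v\<in>UNIV.
        if v = y then if u = x then F u v *s axis (u + v) 1 else 0 else 0)"
    unfolding twisted_mult_def ax by (intro sum.cong refl) simp
  also have "\<dots> = (\<Sum>u\<in>UNIV. if u = x then F u y *s axis (u + y) 1 else 0)"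
    by (subst sum.delta) simp_all
  also have "\<dots> = F x y *s axis (x + y) 1"
    by (subst sum.delta) simp_all
  finally show ?thesis .
qed

lemma twisted_mult_linear_left: "Vector_Spaces.linear (*s) (*s) (\<lambda>a. twisted_mult F a b)"
  by unfold_locales
    (simp_all add: twisted_mult_def sum.distrib vec.scale_sum_right
      vec.scale_left_distrib distrib_right mult.assoc)

lemma twisted_mult_linear_right: "Vector_Spaces.linear (*s) (*s) (twisted_mult F a)"
  by unfold_locales
    (simp_all add: twisted_mult_def sum.distrib vec.scale_sum_right
      vec.scale_left_distrib distrib_left distrib_right mult.assoc mult.left_commute)

definition two_sided_ideal ::
  "('k::field \<Rightarrow> 'a::ab_group_add \<Rightarrow> 'a) \<Rightarrow> ('a \<Rightarrow> 'a \<Rightarrow> 'a) \<Rightarrow> 'a set \<Rightarrow> bool" where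
  "two_sided_ideal smul mul J \<longleftrightarrow>
     module.subspace smul J \<and> (\<forall>a\<in>J. \<forall>b. mul a b \<in> J \<and> mul b a \<in> J)"

definition simple_algebra ::
  "('k::field \<Rightarrow> 'a::ab_group_add \<Rightarrow> 'a) \<Rightarrow> ('a \<Rightarrow> 'a \<Rightarrow> 'a) \<Rightarrow> bool" where
  "simple_algebra smul mul \<longleftrightarrow>
     (\<exists>a b. mul a b \<noteq> 0) \<and> (\<forall>J. two_sided_ideal smul mul J \<longrightarrow> J = {0} \<or> J = UNIV)"

definition noncommutative :: "('a \<Rightarrow> 'a \<Rightarrow> 'a) \<Rightarrow> bool" where
  "noncommutative mul \<longleftrightarrow> (\<exists>a b. mul a b \<noteq> mul b a)"

lemma paley_H_index:
  assumes "i \<le> q" "j \<le> q"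
  shows "(paley_H q e :: 'k::field mat) $$ (i, j) =
    (if i = 0 \<or> j = 0 then 1
     else if i = j then - 1
     else - of_int (quadratic_character (e i - e j)))"
  using assms
  by (auto simp: paley_H_def paley_Q_def four_block_mat_def quadratic_character_def)

lemma cochain_matrix_eq_paley_H_iff:
  fixes F :: "'g::zero \<Rightarrow> 'g \<Rightarrow> 'k::field" and e :: "nat \<Rightarrow> 'f::field"
  assumes bij: "bij_betw g {0..q} UNIV" and g0: "g 0 = 0"
  shows "cochain_matrix (q + 1) g F = paley_H q e \<longleftrightarrow>
    (\<forall>x. F 0 x = 1 \<and> F x 0 = 1) \<and> (\<forall>x. x \<noteq> 0 \<longrightarrow> F x x = - 1) \<and>
    (\<forall>i\<in>{1..q}. \<forall>j\<in>{1..q}. i \<noteq> j \<longrightarrow>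
       F (g i) (g j) = - of_int (quadratic_character (e i - e j)))"
    (is "?L \<longleftrightarrow> ?R")
proof -
  have surj: "\<exists>i\<le>q. x = g i" for x
  proof -
    have "x \<in> g ` {0..q}"
      by (simp add: bij_betw_imp_surj_on[OF bij])
    then show ?thesis
      by auto
  qed
  have zero: "g i = 0 \<longleftrightarrow> i = 0" if "i \<le> q" for i
    using inj_onD[OF bij_betw_imp_inj_on[OF bij], of i 0] g0 that by auto
  have dims: "dim_row (paley_H q e :: 'k mat) = q + 1" "dim_col (paley_H q e :: 'k mat) = q + 1"
    by (simp_all add: paley_H_def)
  have L: "?L \<longleftrightarrow> (\<forall>i\<le>q. \<forall>j\<le>q. F (g i) (g j) = paley_H q e $$ (i, j))"
    using dims by (auto simp: cochain_matrix_def mat_eq_iff less_Suc_eq_le)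
  show ?thesis
  proof
    assume ?L
    then have *: "F (g i) (g j) = (if i = 0 \<or> j = 0 then 1 else if i = j then - 1
        else - of_int (quadratic_character (e i - e j)))" if "i \<le> q" "j \<le> q" for i j
      using L that paley_H_index[of i q j e] by simp
    have "F 0 x = 1 \<and> F x 0 = 1 \<and> (x \<noteq> 0 \<longrightarrow> F x x = - 1)" for x
    proof -
      obtain i where i: "i \<le> q" "x = g i"
        using surj[of x] by blast
      show ?thesis
        using *[of 0 i] *[of i 0] *[of i i] i g0 by auto
    qed
    then show ?R
      using * by simp
  next
    assume R: ?R
    have "F (g i) (g j) = paley_H q e $$ (i, j)" if "i \<le> q" "j \<le> q" for i j
      using R zero[OF that(1)] zero[OF that(2)] g0 that paley_H_index[OF that, of e]
      by auto
    then show ?L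
      using L by blast
  qed
qed

lemma cochain_nonzero:
  fixes F :: "'g::zero \<Rightarrow> 'g \<Rightarrow> 'k::field" and e :: "nat \<Rightarrow> 'f::field"
  assumes bij: "bij_betw g {0..q} UNIV" and g0: "g 0 = 0" and e: "inj_on e {1..q}"
    and F: "cochain_matrix (q + 1) g F = paley_H q e"
  shows "F x y \<noteq> 0"
proof -
  have surj: "\<exists>i\<le>q. z = g i" for z
  proof -
    have "z \<in> g ` {0..q}"
      by (simp add: bij_betw_imp_surj_on[OF bij])
    then show ?thesis
      by auto
  qed
  obtain i where i: "i \<le> q" "g i = x"
    using surj[of x] by metis
  obtain j where j: "j \<le> q" "g j = y"
    using surj[of y] by metis
  have "F x y = cochain_matrix (q + 1) g F $$ (i, j)"
    using i j by (simp add: cochain_matrix_def)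
  also have "\<dots> = (if i = 0 \<or> j = 0 then 1 else if i = j then - 1
      else - of_int (quadratic_character (e i - e j)))"
    unfolding F by (rule paley_H_index[OF i(1) j(1)])
  finally have *: "F x y = (if i = 0 \<or> j = 0 then 1 else if i = j then - 1
      else - of_int (quadratic_character (e i - e j)))" .
  show ?thesis
  proof (cases "i = 0 \<or> j = 0 \<or> i = j")
    case True
    then show ?thesis
      using * by auto
  next
    case False
    then have "e i - e j \<noteq> 0"
      using inj_onD[OF e, of i j] i(1) j(1) by auto
    then show ?thesis
      using False * by (simp add: quadratic_character_def)
  qed
qed

end

theory Submission
  imports Defs "HOL-Number_Theory.Residues"
begin

text \<open>
  Two distinct nonidentity basis elements of \<open>k\<^sub>F G\<close> anticommute. Indeed
  \<open>q = 2 ^ m - 1\<close> is congruent to 3 modulo 4, so \<open>- 1\<close> is not a square in the field with \<open>q\<close>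
  elements, the quadratic character is odd, and the nontrivial part of the cochain is
  skew-symmetric off the diagonal. This gives noncommutativity at once, as \<open>2 \<noteq> 0\<close> in \<open>k\<close>.

  Anticommutativity also gives simplicity, by an argument that never reassociates a product. For
  \<open>x \<noteq> e\<close> the anticommutator \<open>x a + a x\<close> kills every coordinate
  of \<open>a\<close> except those at \<open>e\<close> and \<open>x\<close>; up to the factor 2 it
  equals \<open>a\<^sub>e x - a\<^sub>x e\<close> (lemma \<open>anticommutator_axis\<close>). Let
  \<open>a\<close> be a nonzero element of an ideal \<open>J\<close>. If \<open>a\<close> is a
  multiple of \<open>e\<close>, then \<open>J\<close> contains the unit. Otherwise
  \<open>a\<^sub>x \<noteq> 0\<close> for some \<open>x \<noteq> e\<close>; since the group has a
  further element \<open>y \<noteq> e\<close>, applying the same operation with \<open>y\<close>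
  to \<open>a\<^sub>e x - a\<^sub>x e\<close> leaves the nonzero multiple
  \<open>- a\<^sub>x y\<close> of \<open>y\<close> in \<open>J\<close>, and \<open>y y = - e\<close> again puts the
  unit into \<open>J\<close>.
\<close>

section \<open>The quadratic character of a field of order 3 modulo 4\<close>

text \<open>
  Multiplication by \<open>x\<close> permutes the nonzero elements, hence preserves their product.
\<close>

lemma finite_field_power_card_minus_one:
  fixes x :: "'f::{finite,field}"
  assumes "x \<noteq> 0"
  shows "x ^ (CARD('f) - 1) = 1"
proof -
  let ?U = "UNIV - {0::'f}"
  have "bij_betw ((*) x) ?U ?U"
    by (rule bij_betw_byWitness[where f' = "\<lambda>y. y / x"]) (use assms in auto)
  then have "(\<Prod>y\<in>?U. x * y) = \<Prod>?U"
    by (rule prod.reindex_bij_betw)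
  then have "x ^ card ?U * \<Prod>?U = \<Prod>?U"
    by (simp add: prod.distrib)
  moreover have "\<Prod>?U \<noteq> 0"
    by simp
  ultimately show ?thesis
    by (simp add: card_Diff_singleton)
qed

lemma one_plus_one_neq_zero:
  assumes "CHAR('a::field) \<noteq> 2"
  shows "(1 + 1 :: 'a) \<noteq> 0"
proof
  assume "(1 + 1 :: 'a) = 0"
  then have "of_nat 2 = (0::'a)"
    by simp
  then have "CHAR('a) dvd 2"
    by (simp only: of_nat_eq_0_iff_char_dvd)
  then have "CHAR('a) = 1 \<or> CHAR('a) = 2"
    by (metis prime_nat_iff two_is_prime_nat)
  then show False
    using CHAR_not_1'[where 'a = 'a] assms by simp
qed

text \<open>
  Exactly one of \<open>x\<close> and \<open>- x\<close> is a square. Write the order of the multiplicative group as \<open>2 n\<close>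
  with \<open>n\<close> odd. Nonzero squares satisfy \<open>x ^ n = 1\<close>, so \<open>x\<close> and \<open>- x\<close> cannot both be squares.
  Conversely \<open>x ^ n\<close> is \<open>1\<close> or \<open>- 1\<close>, and since \<open>n + 1\<close> is even, the square of
  \<open>x ^ ((n + 1) / 2)\<close> is \<open>x\<close> or \<open>- x\<close>.
\<close>

lemma quadratic_character_minus:
  fixes x :: "'f::{finite,field}"
  assumes card: "CARD('f) mod 4 = 3"
  shows "quadratic_character (- x) = - quadratic_character x"
proof (cases "x = 0")
  case True
  then show ?thesis
    by (simp add: quadratic_character_def)
next
  case False
  define k where "k = CARD('f) div 4"
  have q: "CARD('f) - 1 = 2 * (2 * k + 1)"
    unfolding k_def using card by presburger
  have "odd CARD('f)"
    using card by presburger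
  then have two: "(1 + 1 :: 'f) \<noteq> 0"
    using CHAR_dvd_CARD[where 'a = 'f] by (intro one_plus_one_neq_zero) auto
  have not_both: False if "x = y ^ 2" "- x = z ^ 2" for y z
  proof -
    have "x ^ (2 * k + 1) = 1"
      using finite_field_power_card_minus_one[of y] False that(1)
      unfolding q power_mult by force
    moreover have "(- x) ^ (2 * k + 1) = 1"
      using finite_field_power_card_minus_one[of z] False that(2)
      unfolding q power_mult by force
    ultimately have "- 1 = (1::'f)"
      by simp
    then show False
      using two by (metis add.right_inverse)
  qed
  have one: "(\<exists>y. x = y ^ 2) \<or> (\<exists>y. - x = y ^ 2)"
  proof -
    have "(x ^ (2 * k + 1)) ^ 2 = 1"
      using finite_field_power_card_minus_one[OF False]
      unfolding q by (simp only: power_mult[symmetric] mult.commute[of _ 2])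
    then have "x ^ (2 * k + 1) = 1 \<or> x ^ (2 * k + 1) = - 1"
      by (simp only: power2_eq_1_iff)
    moreover have "(x ^ (k + 1)) ^ 2 = x * x ^ (2 * k + 1)"
    proof -
      have "(k + 1) * 2 = Suc (2 * k + 1)"
        by simp
      then show ?thesis
        by (simp only: power_mult[symmetric] power_Suc)
    qed
    ultimately have "(x ^ (k + 1)) ^ 2 = x \<or> (x ^ (k + 1)) ^ 2 = - x"
      by auto
    then show ?thesis
      by metis
  qed
  show ?thesis
    using not_both one False by (auto simp: quadratic_character_def)
qed

section \<open>Anticommutative cochains on elementary abelian 2-groups\<close>

lemma twisted_mult_axis_left:
  "twisted_mult F (axis x 1) a = (\<Sum>y\<in>UNIV. (a $ y * F x y) *s axis (x + y) 1)"
proof -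
  have "twisted_mult F (axis x 1) a =
      (\<Sum>u\<in>UNIV. if u = x then \<Sum>y\<in>UNIV. (a $ y * F u y) *s axis (u + y) 1 else 0)"
    unfolding twisted_mult_def by (intro sum.cong refl) (simp add: axis_def)
  then show ?thesis
    by simp
qed

lemma twisted_mult_axis_right:
  fixes F :: "'g::{finite,group_add} \<Rightarrow> 'g \<Rightarrow> 'k::field"
  shows "twisted_mult F a (axis x 1) = (\<Sum>y\<in>UNIV. (a $ y * F y x) *s axis (y + x) 1)"
  unfolding twisted_mult_def
proof (intro sum.cong refl)
  fix y
  have "(\<Sum>u\<in>UNIV. (a $ y * axis x 1 $ u * F y u) *s axis (y + u) 1) =
      (\<Sum>u\<in>UNIV. if u = x then (a $ y * F y u) *s axis (y + u) (1::'k) else 0)"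
    by (intro sum.cong refl) (simp add: axis_def)
  then show "(\<Sum>u\<in>UNIV. (a $ y * axis x 1 $ u * F y u) *s axis (y + u) 1) =
      (a $ y * F y x) *s axis (y + x) 1"
    by simp
qed

lemma twisted_mult_one_left:
  assumes "\<And>x. F 0 x = 1"
  shows "twisted_mult F (axis 0 1) a = a"
  using assms by (simp add: twisted_mult_axis_left basis_expansion)

text \<open>
  The quaternions and the octonions come from cochains of this kind; the cocycle identity is
  not among the axioms, so that the twisted algebra need not be associative.
\<close>

locale anticommutative_cochain =
  fixes F :: "'g::{finite,ab_group_add} \<Rightarrow> 'g \<Rightarrow> 'k::field"
  assumes exponent_two: "x + x = (0::'g)"
    and two_neq_zero: "(1 + 1 :: 'k) \<noteq> 0"
    and unit_left: "F 0 x = 1"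
    and unit_right: "F x 0 = 1"
    and square_neq_zero: "F x x \<noteq> 0"
    and anticommute: "x \<noteq> 0 \<Longrightarrow> y \<noteq> 0 \<Longrightarrow> x \<noteq> y \<Longrightarrow> F x y = - F y x"
begin

text \<open>
  In \<open>x a + a x\<close> the coordinate \<open>a\<^sub>y\<close> gets the factor \<open>F x y + F y x\<close>, which vanishes unless
  \<open>y\<close> is \<open>0\<close> or \<open>x\<close>.
\<close>

lemma anticommutator_axis:
  assumes "x \<noteq> 0"
  shows "twisted_mult F (axis x 1) a + twisted_mult F a (axis x 1) =
    (1 + 1) *s ((a $ 0) *s axis x 1 + (a $ x * F x x) *s axis 0 1)"
proof -
  have "twisted_mult F (axis x 1) a + twisted_mult F a (axis x 1) =
      (\<Sum>y\<in>UNIV. (a $ y * (F x y + F y x)) *s axis (x + y) 1)"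
    unfolding twisted_mult_axis_left twisted_mult_axis_right
    by (simp add: sum.distrib[symmetric] add.commute[of _ x] vec.scale_left_distrib distrib_left)
  also have "\<dots> = (\<Sum>y\<in>{0, x}. (a $ y * (F x y + F y x)) *s axis (x + y) 1)"
    by (rule sum.mono_neutral_right) (use assms anticommute in auto)
  also have "\<dots> = (1 + 1) *s ((a $ 0) *s axis x 1 + (a $ x * F x x) *s axis 0 1)"
    using assms
    by (simp add: unit_left unit_right exponent_two vec.scale_right_distrib mult.commute
        mult.left_commute)
  finally show ?thesis .
qed

lemma ideal_contains_coordinates:
  assumes J: "two_sided_ideal (*s) (twisted_mult F) J" and a: "a \<in> J" and x: "x \<noteq> 0"
  shows "(a $ 0) *s axis x 1 + (a $ x * F x x) *s axis 0 1 \<in> J" (is "?b \<in> J")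
proof -
  have sub: "vec.subspace J"
    using J by (simp add: two_sided_ideal_def)
  have "twisted_mult F (axis x 1) a + twisted_mult F a (axis x 1) \<in> J"
    using J a by (intro vec.subspace_add[OF sub]) (auto simp: two_sided_ideal_def)
  then have "(1 + 1) *s ?b \<in> J"
    by (simp only: anticommutator_axis[OF x])
  then have "inverse (1 + 1) *s ((1 + 1) *s ?b) \<in> J"
    by (rule vec.subspace_scale[OF sub])
  then show ?thesis
    by (simp only: vec.scale_scale left_inverse[OF two_neq_zero] vec.scale_one)
qed

text \<open>
  Every basis element has a nonzero multiple of the unit as its square.
\<close>

lemma ideal_eq_UNIV_if_axis:
  assumes J: "two_sided_ideal (*s) (twisted_mult F) J" and c: "c \<noteq> 0" and x: "c *s axis x 1 \<in> J"
  shows "J = UNIV"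
proof -
  have sub: "vec.subspace J"
    using J by (simp add: two_sided_ideal_def)
  have "inverse c *s (c *s axis x 1) \<in> J"
    using x by (rule vec.subspace_scale[OF sub])
  then have "axis x 1 \<in> J"
    using c by simp
  then have "twisted_mult F (axis x 1) (axis x 1) \<in> J"
    using J by (simp add: two_sided_ideal_def)
  then have "inverse (F x x) *s (F x x *s axis 0 1) \<in> J"
    unfolding twisted_mult_axis exponent_two by (rule vec.subspace_scale[OF sub])
  then have "axis 0 1 \<in> J"
    using square_neq_zero[of x] by simp
  then have "b \<in> J" for b
    using J twisted_mult_one_left[of F b] unit_left unfolding two_sided_ideal_def by metis
  then show ?thesis
    by blast
qed

text \<open>
  Taking anticommutators twice, with two different basis elements, isolates a single coordinate.
  The second basis element is the reason for requiring more than two group elements. For the group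
  of order 2 the algebra is \<open>k[i]\<close> with \<open>i ^ 2 = c \<noteq> 0\<close>, which fails to be simple when \<open>c\<close> is a
  square.
\<close>

lemma nonzero_ideal_eq_UNIV:
  assumes card: "2 < CARD('g)"
    and J: "two_sided_ideal (*s) (twisted_mult F) J" and nz: "J \<noteq> {0}"
  shows "J = UNIV"
proof -
  have sub: "vec.subspace J"
    using J by (simp add: two_sided_ideal_def)
  obtain a where a: "a \<in> J" "a \<noteq> 0"
    using nz vec.subspace_0[OF sub] by blast
  show ?thesis
  proof (cases "\<exists>x. x \<noteq> 0 \<and> a $ x \<noteq> 0")
    case True
    then obtain x where x: "x \<noteq> 0" "a $ x \<noteq> 0"
      by blast
    have "\<not> UNIV \<subseteq> {0, x}"
      using card card_mono[of "{0, x}" UNIV] card_insert_le_m1[of 2 "{x}" 0] by auto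
    then obtain y where y: "y \<noteq> 0" "y \<noteq> x"
      by blast
    \<comment> \<open>The unit coordinate of \<open>b\<close> is a multiple of \<open>a $ x\<close>, and \<open>b\<close> has no coordinate at \<open>y\<close>.\<close>
    define b where "b = (a $ 0) *s axis x 1 + (a $ x * F x x) *s axis 0 1"
    have b: "b $ 0 = a $ x * F x x" "b $ y = 0"
      using x y by (simp_all add: b_def axis_def)
    have "b \<in> J"
      unfolding b_def by (rule ideal_contains_coordinates[OF J a(1) x(1)])
    from ideal_contains_coordinates[OF J this y(1)] have "(a $ x * F x x) *s axis y 1 \<in> J"
      by (simp add: b)
    then show ?thesis
      by (rule ideal_eq_UNIV_if_axis[OF J, rotated]) (simp add: x square_neq_zero)
  next
    case False
    then have "a $ y = ((a $ 0) *s axis 0 1) $ y" for y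
      by (cases "y = 0") (auto simp: axis_def)
    then have "a = (a $ 0) *s axis 0 1"
      by (intro iffD2[OF Finite_Cartesian_Product.vec_eq_iff] allI)
    then obtain c where c: "a = c *s axis 0 1" ..
    then have "c \<noteq> 0" "c *s axis 0 1 \<in> J"
      using a by auto
    then show ?thesis
      by (rule ideal_eq_UNIV_if_axis[OF J])
  qed
qed

theorem simple_algebra_twisted_mult:
  assumes "2 < CARD('g)"
  shows "simple_algebra (*s) (twisted_mult F)"
proof -
  have "twisted_mult F (axis 0 1) (axis 0 1) \<noteq> 0"
    by (simp add: twisted_mult_one_left unit_left)
  then show ?thesis
    unfolding simple_algebra_def using nonzero_ideal_eq_UNIV[OF assms] by blast
qed

theorem noncommutative_twisted_mult:
  assumes "x \<noteq> 0" "y \<noteq> 0" "x \<noteq> y" "F x y \<noteq> 0"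
  shows "noncommutative (twisted_mult F)"
proof -
  have "F x y \<noteq> F y x"
  proof
    assume "F x y = F y x"
    then have "(1 + 1) * F x y = 0"
      using anticommute[OF assms(1-3)] by (simp add: distrib_right)
    then show False
      using two_neq_zero assms(4) by simp
  qed
  then have "twisted_mult F (axis x 1) (axis y 1) $ (x + y) \<noteq>
      twisted_mult F (axis y 1) (axis x 1) $ (x + y)"
    by (simp add: twisted_mult_axis add.commute[of y x])
  then show ?thesis
    unfolding noncommutative_def by metis
qed

end

section \<open>Paley cochains\<close>

lemma paley_cochain_anticommute:
  fixes e :: "nat \<Rightarrow> 'f::{finite,field}" and F :: "'g::zero \<Rightarrow> 'g \<Rightarrow> 'k::field"
  assumes card: "CARD('f) mod 4 = 3"
    and g: "bij_betw g {0..q} UNIV" "g 0 = 0"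
    and F: "cochain_matrix (q + 1) g F = paley_H q e"
    and xy: "x \<noteq> 0" "y \<noteq> 0" "x \<noteq> y"
  shows "F x y = - F y x"
proof -
  have nonzero_index: "\<exists>i\<in>{1..q}. z = g i" if "z \<noteq> 0" for z
  proof -
    have "z \<in> g ` {0..q}"
      by (simp add: bij_betw_imp_surj_on[OF g(1)])
    then obtain i where "i \<le> q" "z = g i"
      by auto
    with that g(2) show ?thesis
      by (cases i) auto
  qed
  obtain i j where ij: "i \<in> {1..q}" "x = g i" "j \<in> {1..q}" "y = g j"
    using nonzero_index xy by metis
  have "i \<noteq> j"
    using ij xy by auto
  then have "F x y = - of_int (quadratic_character (e i - e j))"
    and "F y x = - of_int (quadratic_character (e j - e i))"
    using F ij unfolding cochain_matrix_eq_paley_H_iff[OF g] by auto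
  then show ?thesis
    using quadratic_character_minus[OF card, of "e i - e j"] by simp
qed

theorem proposition5p2:
  fixes e :: "nat \<Rightarrow> 'f::{finite,field}"
    and g :: "nat \<Rightarrow> bit ^ 'n::finite"
    and F :: "bit ^ 'n \<Rightarrow> bit ^ 'n \<Rightarrow> 'k::field"
    and p r m q :: nat
  assumes "CHAR('k) \<noteq> 2"
    and "prime p" and "odd p" and "r \<ge> 1" and "m \<ge> 2"
    and "q = p ^ r" and "q + 1 = 2 ^ m"
    and "CARD('f) = q" and "bij_betw e {1..q} UNIV"
    and "CARD('n) = m" and "bij_betw g {0..q} UNIV" and "g 0 = 0"
    and "cochain_matrix (q + 1) g F = paley_H q e"
  shows "simple_algebra (*s) (twisted_mult F) \<and> noncommutative (twisted_mult F)"
proof -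
  note g = assms(11,12) and F = assms(13)
  have "4 dvd (2::nat) ^ m"
    using le_imp_power_dvd[OF assms(5), of "2::nat"] by simp
  then have "CARD('f) mod 4 = 3" and q: "3 \<le> q"
    using assms(7,8) by presburger+
  note anticommute = paley_cochain_anticommute[OF this(1) g F]
  have "CARD(bit ^ 'n) = q + 1"
    using bij_betw_same_card[OF g(1)] by simp
  then have card: "2 < CARD(bit ^ 'n)"
    using q by simp
  have nonzero: "F x y \<noteq> 0" for x y
    by (rule cochain_nonzero[OF g bij_betw_imp_inj_on[OF assms(9)] F])
  have two: "(1 + 1 :: 'k) \<noteq> 0"
    by (rule one_plus_one_neq_zero[OF assms(1)])
  interpret anticommutative_cochain F
  proof
    show "x + x = 0" for x :: "bit ^ 'n"
    proof -
      have "(x + x) $ i = 0 $ i" for i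
        by (cases "x $ i") simp_all
      then show ?thesis
        by (intro iffD2[OF Finite_Cartesian_Product.vec_eq_iff] allI)
    qed
    show "F 0 x = 1" "F x 0 = 1" for x
      using F unfolding cochain_matrix_eq_paley_H_iff[OF g] by blast+
  qed (rule two nonzero anticommute; assumption)+
  note inj = inj_on_eq_iff[OF bij_betw_imp_inj_on[OF g(1)]]
  have "g 1 \<noteq> 0" "g 2 \<noteq> 0" "g 1 \<noteq> g 2"
    using inj[of 1 0] inj[of 2 0] inj[of 1 2] g(2) q by auto
  then show ?thesis
    using simple_algebra_twisted_mult[OF card] noncommutative_twisted_mult nonzero by blast
qed

end
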